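(* For every integer $n\ge 1$, the partition graph $G_n$, and hence the clique complex $K_n$ of $G_n$, is connected.
   Context: A partition of a positive integer $n$ is a weakly decreasing sequence $\lambda=(\lambda_1\ge\cdots\ge\lambda_\ell>0)$ of positive integers with sum $n$; it is identified with its Ferrers diagram, the left-justified array with $\lambda_i$ cells in row $i$. The partition graph $G_n$ is the simple graph whose vertices are all partitions of $n$; two distinct partitions are adjacent if one can be obtained from the other by removing one cell from a row of the Ferrers diagram, adding it to another row (possibly a new row, i.e. a row of length $0$), and then reordering the row lengths into weakly decreasing order (discarding zeros). $K_n:=\mathrm{Cl}(G_n)$ is the clique complex of $G_n$: the simplicial complex whose simplices are the finite nonempty cliques of $G_n$. *)

theory Defs
  imports "HOL-Analysis.Function_Topology" "Graph_Theory.Digraph_Component"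
begin

section \<open>The partition graph\<close>

definition partitions_of :: "nat \<Rightarrow> nat list set" where
  "partitions_of n = {xs. sorted_wrt (\<ge>) xs \<and> (\<forall>k\<in>set xs. 0 < k) \<and> sum_list xs = n}"

text \<open>The diagram is padded with a single row of length \<open>0\<close>, so that the target index
  \<open>j = length xs\<close> means that the cell starts a new row.\<close>

definition move_cell :: "nat \<Rightarrow> nat \<Rightarrow> nat list \<Rightarrow> nat list" where
  "move_cell i j xs =
     (let ys = xs @ [0]
      in rev (sort (filter (\<lambda>k. k \<noteq> 0) (ys[i := ys ! i - 1, j := ys ! j + 1]))))"

definition cell_move :: "nat list \<Rightarrow> nat list \<Rightarrow> bool" where
  "cell_move xs ys \<longleftrightarrow>
     (\<exists>i < length xs. \<exists>j \<le> length xs. i \<noteq> j \<and> ys = move_cell i j xs)"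

text \<open>Each undirected edge is represented by its two orientations.\<close>

definition partition_graph :: "nat \<Rightarrow> nat list pair_pre_digraph" where
  "partition_graph n =
     \<lparr> pverts = partitions_of n,
       parcs = {(xs, ys). xs \<in> partitions_of n \<and> ys \<in> partitions_of n \<and> xs \<noteq> ys \<and>
                  (cell_move xs ys \<or> cell_move ys xs)} \<rparr>"

lemma finite_partitions_of: "finite (partitions_of n)"
proof (rule finite_subset)
  show "partitions_of n \<subseteq> {xs. set xs \<subseteq> {..n} \<and> length xs \<le> n}"
  proof
    fix xs assume "xs \<in> partitions_of n"
    then have pos: "\<forall>k\<in>set xs. 0 < k" and sum: "sum_list xs = n"
      by (auto simp: partitions_of_def)
    have "length xs \<le> sum_list xs"
      using pos by (induction xs) auto
    moreover have "\<forall>k\<in>set xs. k \<le> sum_list xs"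
      by (simp add: member_le_sum_list)
    ultimately show "xs \<in> {xs. set xs \<subseteq> {..n} \<and> length xs \<le> n}"
      using sum by auto
  qed
  show "finite {xs. set xs \<subseteq> {..n} \<and> length xs \<le> n}"
    by (rule finite_lists_length_le) simp
qed

lemma pair_graph_partition_graph: "pair_graph (partition_graph n)"
proof
  have "parcs (partition_graph n) \<subseteq> partitions_of n \<times> partitions_of n"
    by (auto simp: partition_graph_def)
  then show "finite (parcs (partition_graph n))"
    by (rule finite_subset) (simp add: finite_partitions_of)
  show "symmetric (partition_graph n)"
    by (auto simp: symmetric_def arcs_ends_def arc_to_ends_def partition_graph_def sym_def)
qed (auto simp: partition_graph_def finite_partitions_of)


section \<open>Clique complexes and geometric realization\<close>

definition clique_complex :: "('a, 'b) pre_digraph \<Rightarrow> 'a set set" where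
  "clique_complex G =
     {\<sigma>. finite \<sigma> \<and> \<sigma> \<noteq> {} \<and> \<sigma> \<subseteq> verts G \<and> (\<forall>u\<in>\<sigma>. \<forall>v\<in>\<sigma>. u \<noteq> v \<longrightarrow> u \<rightarrow>\<^bsub>G\<^esub> v)}"

text \<open>A point of the closed simplex on the finite set \<open>\<sigma>\<close> is given by its barycentric
  coordinates, extended by \<open>0\<close> to all vertices. On such a simplex the product topology of
  the function type is the Euclidean topology.\<close>

definition geometric_simplex :: "'a set \<Rightarrow> ('a \<Rightarrow> real) set" where
  "geometric_simplex \<sigma> = {x. (\<forall>v. 0 \<le> x v) \<and> (\<forall>v. v \<notin> \<sigma> \<longrightarrow> x v = 0) \<and> (\<Sum>v\<in>\<sigma>. x v) = 1}"

text \<open>The realization carries the weak topology: a set is open iff it meets every closed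
  simplex in a relatively open set.\<close>

definition geometric_realization :: "'a set set \<Rightarrow> ('a \<Rightarrow> real) topology" where
  "geometric_realization K =
     topology (\<lambda>U. U \<subseteq> (\<Union>\<sigma>\<in>K. geometric_simplex \<sigma>) \<and>
       (\<forall>\<sigma>\<in>K. openin (top_of_set (geometric_simplex \<sigma>)) (U \<inter> geometric_simplex \<sigma>)))"

lemma openin_geometric_realization:
  "openin (geometric_realization K) U \<longleftrightarrow>
     U \<subseteq> (\<Union>\<sigma>\<in>K. geometric_simplex \<sigma>) \<and>
       (\<forall>\<sigma>\<in>K. openin (top_of_set (geometric_simplex \<sigma>)) (U \<inter> geometric_simplex \<sigma>))"
proof -
  let ?P = "\<lambda>U. U \<subseteq> (\<Union>\<sigma>\<in>K. geometric_simplex \<sigma>) \<and>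
       (\<forall>\<sigma>\<in>K. openin (top_of_set (geometric_simplex \<sigma>)) (U \<inter> geometric_simplex \<sigma>))"
  have "istopology ?P"
    unfolding istopology_def
  proof (intro conjI allI impI)
    fix S T assume S: "?P S" and T: "?P T"
    show "S \<inter> T \<subseteq> (\<Union>\<sigma>\<in>K. geometric_simplex \<sigma>)"
      using S by blast
    show "\<forall>\<sigma>\<in>K. openin (top_of_set (geometric_simplex \<sigma>)) (S \<inter> T \<inter> geometric_simplex \<sigma>)"
    proof
      fix \<sigma> assume "\<sigma> \<in> K"
      then have "openin (top_of_set (geometric_simplex \<sigma>))
          ((S \<inter> geometric_simplex \<sigma>) \<inter> (T \<inter> geometric_simplex \<sigma>))"
        using S T by (blast intro: openin_Int)
      then show "openin (top_of_set (geometric_simplex \<sigma>)) (S \<inter> T \<inter> geometric_simplex \<sigma>)"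
        by (simp add: Int_ac)
    qed
  next
    fix \<U> assume \<U>: "\<forall>S\<in>\<U>. ?P S"
    then show "\<Union>\<U> \<subseteq> (\<Union>\<sigma>\<in>K. geometric_simplex \<sigma>)"
      by blast
    show "\<forall>\<sigma>\<in>K. openin (top_of_set (geometric_simplex \<sigma>)) (\<Union>\<U> \<inter> geometric_simplex \<sigma>)"
    proof
      fix \<sigma> assume "\<sigma> \<in> K"
      then have "openin (top_of_set (geometric_simplex \<sigma>)) (\<Union>S\<in>\<U>. S \<inter> geometric_simplex \<sigma>)"
        using \<U> by (blast intro: openin_Union)
      then show "openin (top_of_set (geometric_simplex \<sigma>)) (\<Union>\<U> \<inter> geometric_simplex \<sigma>)"
        by (simp add: Int_commute Int_Union)
    qed
  qed
  then show ?thesis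
    by (simp add: geometric_realization_def topology_inverse')
qed

lemma topspace_geometric_realization:
  "topspace (geometric_realization K) = (\<Union>\<sigma>\<in>K. geometric_simplex \<sigma>)"
proof (rule antisym)
  show "topspace (geometric_realization K) \<subseteq> (\<Union>\<sigma>\<in>K. geometric_simplex \<sigma>)"
    using openin_topspace[of "geometric_realization K"]
    unfolding openin_geometric_realization by blast
  have "(\<Union>\<sigma>\<in>K. geometric_simplex \<sigma>) \<inter> geometric_simplex \<tau> = geometric_simplex \<tau>"
    if "\<tau> \<in> K" for \<tau>
    using that by blast
  then have "openin (geometric_realization K) (\<Union>\<sigma>\<in>K. geometric_simplex \<sigma>)"
    by (simp add: openin_geometric_realization)
  then show "(\<Union>\<sigma>\<in>K. geometric_simplex \<sigma>) \<subseteq> topspace (geometric_realization K)"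
    by (rule openin_subset)
qed

text \<open>As for graphs, the empty complex does not count as connected.\<close>

definition complex_connected :: "'a set set \<Rightarrow> bool" where
  "complex_connected K \<longleftrightarrow> K \<noteq> {} \<and> connected_space (geometric_realization K)"

end

theory Submission
  imports Defs
begin

text \<open>Moving a cell from the last row to the first row of a partition with at least two rows
  lengthens the first row, so iterating this move leads every partition to the one-row partition
  of \<open>n\<close>. In the realization, two points of a common simplex are joined by a straight
  segment; thus every point is connected to a vertex, and adjacent vertices are connected
  to each other.\<close>

lemma in_parcs_partition_graph_iff:
  "(xs, ys) \<in> parcs (partition_graph n) \<longleftrightarrow>
     xs \<in> partitions_of n \<and> ys \<in> partitions_of n \<and> xs \<noteq> ys \<and> (cell_move xs ys \<or> cell_move ys xs)"
  by (simp add: partition_graph_def)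

text \<open>Raising the first entry and lowering the last one keeps the list weakly decreasing, so
  the re-sorting in \<open>move_cell\<close> changes nothing. The \<open>filter\<close> on
  \<open>[b - 1]\<close> makes the last row vanish when \<open>b = 1\<close>.\<close>

lemma move_cell_last_first:
  assumes "sorted_wrt (\<ge>) (a # ms @ [b])" and pos: "\<forall>k\<in>set (a # ms @ [b]). 0 < k"
  shows "move_cell (Suc (length ms)) 0 (a # ms @ [b]) =
     Suc a # ms @ filter (\<lambda>k. k \<noteq> 0) [b - 1]"
proof -
  let ?us = "Suc a # ms @ filter (\<lambda>k. k \<noteq> 0) [b - 1]"
  have "filter (\<lambda>k. k \<noteq> 0) ms = ms"
    using pos by (auto simp: filter_id_conv)
  then have "move_cell (Suc (length ms)) 0 (a # ms @ [b]) = rev (sort ?us)"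
    by (simp add: move_cell_def Let_def nth_append list_update_append)
  moreover have "sorted (rev ?us)"
    using assms(1) by (auto simp: sorted_wrt_append sorted_wrt_rev)
  then have "sort ?us = rev ?us"
    by (intro properties_for_sort) simp
  ultimately show ?thesis by simp
qed

text \<open>Supplies the step that makes the induction on \<open>n - hd xs\<close> progress.\<close>

lemma partition_with_two_rows_dominates_larger_hd:
  assumes "xs \<in> partitions_of n" and "2 \<le> length xs"
  obtains ys where "xs \<rightarrow>\<^bsub>with_proj (partition_graph n)\<^esub> ys" and "hd ys = Suc (hd xs)"
proof -
  obtain a zs where "xs = a # zs" "zs \<noteq> []"
    using assms(2) by (cases xs) force+
  then obtain ms b where xs: "xs = a # ms @ [b]"
    by (metis rev_exhaust)
  define ys where "ys = Suc a # ms @ filter (\<lambda>k. k \<noteq> 0) [b - 1]"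
  have desc: "sorted_wrt (\<ge>) (a # ms @ [b])" and pos: "\<forall>k\<in>set (a # ms @ [b]). 0 < k"
    using assms(1) by (auto simp: partitions_of_def xs)
  have "ys = move_cell (Suc (length ms)) 0 xs"
    unfolding ys_def xs using desc pos by (rule move_cell_last_first [symmetric])
  then have "cell_move xs ys"
    unfolding cell_move_def
    by (intro exI [of _ "Suc (length ms)"] conjI exI [of _ 0]) (simp_all add: xs)
  moreover have "ys \<in> partitions_of n"
    \<comment> \<open>The sum is preserved because \<open>b\<close> is positive, so
      \<open>b - 1\<close> is not truncated.\<close>
    using assms(1) by (auto simp: partitions_of_def xs ys_def sorted_wrt_append)
  ultimately show thesis
    using assms(1) by (intro that [of ys]) (auto simp: in_parcs_partition_graph_iff xs ys_def)
qed

lemma one_row_partition: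
  assumes "xs \<in> partitions_of n" and "1 \<le> n" and "length xs < 2"
  shows "xs = [n]"
  using assms by (cases xs) (auto simp: partitions_of_def)

lemma reachable_one_row_partition:
  assumes "xs \<in> partitions_of n" and "1 \<le> n"
  shows "xs \<rightarrow>\<^sup>*\<^bsub>with_proj (partition_graph n)\<^esub> [n]"
  using assms(1)
proof (induction "n - hd xs" arbitrary: xs rule: less_induct)
  case less
  interpret pair_graph "partition_graph n" by (rule pair_graph_partition_graph)
  show ?case
  proof (cases "length xs < 2")
    case True
    then have "xs = [n]"
      using less.prems assms(2) one_row_partition by blast
    then show ?thesis
      using less.prems reachable_refl [of xs] by (simp add: partition_graph_def)
  next
    case False
    then obtain ys where adj: "xs \<rightarrow>\<^bsub>with_proj (partition_graph n)\<^esub> ys"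
      and hd: "hd ys = Suc (hd xs)"
      using less.prems partition_with_two_rows_dominates_larger_hd
      by (metis not_less)
    have ys: "ys \<in> partitions_of n"
      using adj by (simp add: in_parcs_partition_graph_iff)
    then have "ys \<noteq> []"
      using assms(2) by (auto simp: partitions_of_def)
    \<comment> \<open>This bound gives \<open>hd xs < n\<close>, so the truncated difference
      \<open>n - hd xs\<close> strictly drops on passing to \<open>ys\<close>.\<close>
    then have "hd ys \<le> n"
      using ys member_le_sum_list [of "hd ys" ys] by (simp add: partitions_of_def)
    then have "ys \<rightarrow>\<^sup>*\<^bsub>with_proj (partition_graph n)\<^esub> [n]"
      using hd ys by (intro less.hyps) auto
    with adj show ?thesis by (auto intro: adj_reachable_trans)
  qed
qed

text \<open>Any two partitions are joined through \<open>[n]\<close>: symmetry of the graph reverses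
  the second of the two walks to \<open>[n]\<close>.\<close>

lemma strongly_connected_partition_graph:
  assumes "1 \<le> n"
  shows "strongly_connected (with_proj (partition_graph n))"
proof -
  interpret pair_graph "partition_graph n" by (rule pair_graph_partition_graph)
  have "[n] \<in> partitions_of n"
    using assms by (simp add: partitions_of_def)
  moreover have "u \<rightarrow>\<^sup>*\<^bsub>with_proj (partition_graph n)\<^esub> v"
    if "u \<in> partitions_of n" "v \<in> partitions_of n" for u v
    using that assms
    by (meson reachable_one_row_partition reachable_trans symmetric_reachable')
  ultimately show ?thesis
    by (intro strongly_connectedI) (auto simp: partition_graph_def)
qed

lemma segment_in_geometric_simplex:
  assumes "x \<in> geometric_simplex \<sigma>" and "y \<in> geometric_simplex \<sigma>" and "t \<in> {0..1}"
  shows "(\<lambda>v. (1 - t) * x v + t * y v) \<in> geometric_simplex \<sigma>"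
  using assms by (simp add: geometric_simplex_def sum.distrib flip: sum_distrib_left)

text \<open>\<open>indicator {v}\<close> is the vertex \<open>v\<close> seen as a point of the
  realization. Finiteness matters because \<open>sum\<close> over an infinite set is 0 by
  default.\<close>

lemma indicator_in_geometric_simplex:
  assumes "finite \<sigma>" and "v \<in> \<sigma>"
  shows "indicator {v} \<in> geometric_simplex \<sigma>"
  using assms by (auto simp: geometric_simplex_def indicator_def)

lemma connected_component_of_geometric_simplex:
  assumes "\<sigma> \<in> K" and x: "x \<in> geometric_simplex \<sigma>" and y: "y \<in> geometric_simplex \<sigma>"
  shows "connected_component_of (geometric_realization K) x y"
proof -
  define p where "p = (\<lambda>t::real. \<lambda>v. (1 - t) * x v + t * y v)"
  have into: "p \<in> {0..1} \<rightarrow> geometric_simplex \<sigma>"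
    unfolding p_def using x y by (intro Pi_I segment_in_geometric_simplex)
  have "continuous_on {0..1} p"
    unfolding p_def by (intro continuous_intros)
  then have path: "continuous_map (top_of_set {0..1}) (top_of_set (geometric_simplex \<sigma>)) p"
    using into by (simp add: continuous_map_in_subtopology image_subset_iff_funcset)
  \<comment> \<open>The weak topology makes each inclusion of a closed simplex continuous, so the
    segment \<open>p\<close> stays continuous in the realization.\<close>
  have "continuous_map (top_of_set (geometric_simplex \<sigma>)) (geometric_realization K) id"
    using \<open>\<sigma> \<in> K\<close>
    by (auto simp: continuous_map_def topspace_geometric_realization openin_geometric_realization
        Int_def conj_commute)
  from continuous_map_compose [OF path this]
  have "connectedin (geometric_realization K) (p ` {0..1})"
    by (auto intro: connectedin_continuous_map_image simp: connectedin_subtopology)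
  moreover have "x = p 0" "y = p 1"
    by (simp_all add: p_def)
  then have "x \<in> p ` {0..1}" "y \<in> p ` {0..1}"
    by auto
  ultimately show ?thesis
    unfolding connected_component_of_def by blast
qed

text \<open>Only simplices of dimension 0 and 1 are needed to join vertices; the higher ones enter
  only in joining a point to a vertex of its simplex.\<close>

lemma complex_connected_clique_complex:
  assumes "sym_digraph G" and "strongly_connected G"
  shows "complex_connected (clique_complex G)"
proof -
  interpret sym_digraph G by fact
  let ?K = "clique_complex G"
  let ?C = "connected_component_of (geometric_realization ?K)"
  have vertex: "{u} \<in> ?K" if "u \<in> verts G" for u
    using that by (simp add: clique_complex_def)
  \<comment> \<open>A clique needs arcs in both directions, hence the appeal to symmetry.\<close>
  have edge: "{u, v} \<in> ?K" if "u \<rightarrow>\<^bsub>G\<^esub> v" for u v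
    using that adj_in_verts [OF that] sym_arcs
    by (auto simp: clique_complex_def symmetric_def dest: symD)
  have vertices: "?C (indicator {u}) (indicator {v})" if "u \<rightarrow>\<^sup>*\<^bsub>G\<^esub> v" for u v
    using that
  proof (induction rule: reachable_induct)
    case base
    then show ?case
      by (intro connected_component_of_geometric_simplex [OF vertex])
        (auto intro: indicator_in_geometric_simplex)
  next
    case (step v w)
    have "?C (indicator {v}) (indicator {w})"
      using edge [OF step.hyps(2)]
      by (rule connected_component_of_geometric_simplex)
        (auto intro: indicator_in_geometric_simplex)
    with step.IH show ?case by (rule connected_component_of_trans [OF _])
  qed
  have to_vertex: "\<exists>u\<in>verts G. ?C x (indicator {u})"
    if x: "x \<in> topspace (geometric_realization ?K)" for x
  proof -
    obtain \<sigma> where \<sigma>: "\<sigma> \<in> ?K" "x \<in> geometric_simplex \<sigma>"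
      using x by (auto simp: topspace_geometric_realization)
    then obtain u where u: "u \<in> \<sigma>" "finite \<sigma>" "u \<in> verts G"
      by (auto simp: clique_complex_def)
    then show ?thesis
      using \<sigma> connected_component_of_geometric_simplex indicator_in_geometric_simplex by metis
  qed
  have "?C x y"
    if xy: "x \<in> topspace (geometric_realization ?K)" "y \<in> topspace (geometric_realization ?K)" for x y
  proof -
    obtain u v where "u \<in> verts G" "?C x (indicator {u})" "v \<in> verts G" "?C y (indicator {v})"
      using to_vertex [OF xy(1)] to_vertex [OF xy(2)] by blast
    moreover from this have "?C (indicator {u}) (indicator {v})"
      using assms(2) by (intro vertices) auto
    ultimately show ?thesis
      by (meson connected_component_of_sym connected_component_of_trans)
  qed
  moreover have "?K \<noteq> {}"
    using assms(2) vertex by (auto simp: strongly_connected_def)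
  ultimately show ?thesis
    by (simp add: complex_connected_def connected_space_iff_connected_component)
qed

theorem proposition6p1:
  fixes n :: nat
  assumes "n \<ge> 1"
  shows "Digraph_Component.connected (with_proj (partition_graph n)) \<and>
         complex_connected (clique_complex (with_proj (partition_graph n)))"
proof -
  interpret pair_graph "partition_graph n" by (rule pair_graph_partition_graph)
  have sc: "strongly_connected (with_proj (partition_graph n))"
    using assms by (rule strongly_connected_partition_graph)
  \<comment> \<open>The library's \<open>connected\<close> is strong connectivity of the symmetric
    closure, to which reachability passes.\<close>
  then have "Digraph_Component.connected (with_proj (partition_graph n))"
    by (auto simp: Digraph_Component.connected_def strongly_connected_def
        intro: reachable_mk_symmetricI)
  with complex_connected_clique_complex [OF sym_digraph_axioms sc] show ?thesis by blast
qed

end
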